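(* Let $R=D_{2,3,1}$ be the Dekking curve. Let $T=(t_2,\tau)$ be a Thue-Morse turtle curve such that $\alpha_T(\phi(0))=\zeta_{3\cdot 2^b}^{k}$, where $\phi$ is the morphism on $(\mathbb Z/2\mathbb Z)^*$ with $\phi(0)=01$, $\phi(1)=10$, $b\in\mathbb N$, and $k$ is an integer with $\gcd(k,6)=1$. Suppose also that $P_T(\phi(0))\neq P_T(\phi(1))$. Then there is a nontrivial $K\in\mathcal H(\mathbb C)$ which is a limit curve of both $R$ and $T$, and $$\lim_{n\to\infty}3^{-n}\mathcal P(R[:4^n])=K$$ in the Hausdorff metric.
   Context: Notation: $\mathbb N=\{0,1,2,\dots\}$; $\mathbb S^1=\{z\in\mathbb C:|z|=1\}$; $\zeta_m=e^{2\pi i/m}$; $A^*$ is the set of finite words over $A$; $w[j]$ is the letter of the word $w$ at position $j$, starting at $0$. Turtle group: $\mathcal G=\mathbb C\times\mathbb S^1$ with $(z_1,u_1)+(z_2,u_2)=(z_1+u_1z_2,u_1u_2)$ (sums are taken in order from left to right, empty sum $(0,1)$), and projections $\pi_1(z,u)=z$, $\pi_2(z,u)=u$. Turtle curve: a pair $T=(\sigma,\tau)$ where $\sigma:\mathbb N\to A$ is a sequence over a finite alphabet $A$ and $\tau:A\to\mathcal G$ is any function (an interpreter function). It is also viewed as the sequence of points $T(n)=\pi_1\left(\sum_{i=0}^{n-1}\tau(\sigma(i))\right)\in\mathbb C$. For a word $w=a_1\cdots a_m\in A^*$ put $S_T(w)=\tau(a_1)+\cdots+\tau(a_m)$, $P_T(w)=\pi_1(S_T(w))$,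 $\alpha_T(w)=\pi_2(S_T(w))$. An absolute turtle curve is one with $\pi_2(\tau(a))=1$ for all $a\in A$; then $\tau$ is viewed as a map $A\to\mathbb C$ (a complex number $c$ standing for $(c,1)$). Thue-Morse: $t_2:\mathbb N\to\mathbb Z/2\mathbb Z$ is defined by $t_2(0)=0$ and $t_2(2m+s)=t_2(m)+\overline s$ for $m\in\mathbb N$, $0\le s<2$. A Thue-Morse turtle curve over $t_2$ is a turtle curve of the form $(t_2,\tau)$. Dekking curve: $D_{2,3,1}$ is the absolute turtle curve $(z_{2,3},\tau)$, where $z_{2,3}(n)=(t_2(n),\overline n)\in\mathbb Z/2\mathbb Z\times\mathbb Z/3\mathbb Z$ and $\tau((x,y))=(-1)^x\zeta_3^{y}$. Curves and limits: for $x,y\in\mathbb C$ let $\ell(x,y)=\{x+t(y-x):t\in[0,1]\}$. For a turtle curve $T$, $T[:n]$ is the word $T(0)T(1)\cdots T(n-1)$ over $\mathbb C$, and for a word $w$ of length $n$ over $\mathbb C$, $\mathcal P(w)=\bigcup_{i=0}^{n-2}\ell(w[i],w[i+1])$. $\mathcal H(\mathbb C)$ is the set of nonempty compact subsets of $\mathbb C$ with the Hausdorff metric induced by $|x-y|$. $K\in\mathcal H(\mathbb C)$ is a limit curve of $T$ if there exist $\rho,c\in\mathbb C^\times$ with $|\rho|>1$ and a sequence $(b_n)$ of natural numbers such that $\lim_{n\to\infty}\rho^{-n}\mathcal P(T[:b_n])=cK$ in the Hausdorff metric (which requires the sets to be nonempty for all sufficiently large $n$). $K$ is nontrivial if $K\ne\{0\}$.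 *)

theory Defs
  imports "HOL-Analysis.Analysis" "HOL-Library.Numeral_Type"
begin

section \<open>The turtle group\<close>

typedef turtle = "(UNIV :: complex set) \<times> (sphere 0 1 :: complex set)"
  morphisms turtle_pair Turtle
  by (rule exI[of _ "(0, 1)"]) simp

setup_lifting type_definition_turtle

lift_definition turtle_pos :: "turtle \<Rightarrow> complex" is fst .  (* pi_1 *)

lift_definition turtle_dir :: "turtle \<Rightarrow> complex" is snd .  (* pi_2 *)

(* The group is not commutative, so the ordered sums of the turtle group
   are expressed by sum_list. *)
instantiation turtle :: group_add
begin

lift_definition zero_turtle :: turtle is "(0, 1)" by simp

lift_definition plus_turtle :: "turtle \<Rightarrow> turtle \<Rightarrow> turtle"
  is "\<lambda>(z1, u1) (z2, u2). (z1 + u1 * z2, u1 * u2)"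
  by (auto simp: norm_mult)

lift_definition uminus_turtle :: "turtle \<Rightarrow> turtle"
  is "\<lambda>(z, u). (- (inverse u * z), inverse u)"
  by (auto simp: norm_inverse)

definition minus_turtle :: "turtle \<Rightarrow> turtle \<Rightarrow> turtle"
  where "minus_turtle a b = a + - b"

instance
proof
  fix a b c :: turtle
  show "a + b + c = a + (b + c)"
    by transfer (auto simp: algebra_simps)
  show "0 + a = a" "a + 0 = a"
    by (transfer; auto)+
  show "- a + a = 0"
  proof transfer
    fix p :: "complex \<times> complex"
    assume "p \<in> UNIV \<times> sphere 0 1"
    moreover from this have "snd p \<noteq> 0" by auto
    ultimately show "(case (case p of (z, u) \<Rightarrow> (- (inverse u * z), inverse u)) of
        (z1, u1) \<Rightarrow> \<lambda>(z2, u2). (z1 + u1 * z2, u1 * u2)) p = (0, 1)"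
      by (auto split: prod.splits)
  qed
  show "a + - b = a - b"
    by (simp add: minus_turtle_def)
qed

end

(* The identification of c with (c, 1) used for absolute turtle curves. *)
lift_definition translation :: "complex \<Rightarrow> turtle" is "\<lambda>c. (c, 1)" by simp

section \<open>Turtle curves\<close>

type_synonym 'a turtle_curve = "(nat \<Rightarrow> 'a) \<times> ('a \<Rightarrow> turtle)"

definition turtle_point :: "'a::finite turtle_curve \<Rightarrow> nat \<Rightarrow> complex" where
  "turtle_point T n = turtle_pos (\<Sum>i\<leftarrow>[0..<n]. snd T (fst T i))"

definition turtle_prefix :: "'a::finite turtle_curve \<Rightarrow> nat \<Rightarrow> complex list" where
  "turtle_prefix T n = map (turtle_point T) [0..<n]"

definition word_sum :: "'a::finite turtle_curve \<Rightarrow> 'a list \<Rightarrow> turtle" where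
  "word_sum T w = (\<Sum>a\<leftarrow>w. snd T a)"

definition word_pos :: "'a::finite turtle_curve \<Rightarrow> 'a list \<Rightarrow> complex" where
  "word_pos T w = turtle_pos (word_sum T w)"

definition word_dir :: "'a::finite turtle_curve \<Rightarrow> 'a list \<Rightarrow> complex" where
  "word_dir T w = turtle_dir (word_sum T w)"

section \<open>Polygonal paths and limit curves\<close>

(* Truncated subtraction makes the path of the empty word empty, as is the path
   of a one-letter word. *)
definition polygonal_path :: "complex list \<Rightarrow> complex set" where
  "polygonal_path w = (\<Union>i<length w - 1. closed_segment (w ! i) (w ! Suc i))"

definition nonempty_compacts :: "'a::metric_space set set" where
  "nonempty_compacts = {K. compact K \<and> K \<noteq> {}}"

(* The Hausdorff metric on nonempty_compacts; of no significance on other sets. *)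
definition hausdorff_dist :: "'a::metric_space set \<Rightarrow> 'a set \<Rightarrow> real" where
  "hausdorff_dist A B = max (SUP x\<in>A. infdist x B) (SUP y\<in>B. infdist y A)"

definition hausdorff_limit :: "(nat \<Rightarrow> 'a::metric_space set) \<Rightarrow> 'a set \<Rightarrow> bool" where
  "hausdorff_limit X K \<longleftrightarrow>
     K \<in> nonempty_compacts \<and>
     (\<forall>\<^sub>F n in sequentially. X n \<in> nonempty_compacts) \<and>
     (\<lambda>n. hausdorff_dist (X n) K) \<longlonglongrightarrow> 0"

definition limit_curve :: "'a::finite turtle_curve \<Rightarrow> complex set \<Rightarrow> bool" where
  "limit_curve T K \<longleftrightarrow>
     K \<in> nonempty_compacts \<and>
     (\<exists>(\<rho>::complex) (c::complex) (b::nat \<Rightarrow> nat).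
        norm \<rho> > 1 \<and> c \<noteq> 0 \<and>
        hausdorff_limit
          (\<lambda>n. (\<lambda>z. inverse (\<rho> ^ n) * z) ` polygonal_path (turtle_prefix T (b n)))
          ((\<lambda>z. c * z) ` K))"

section \<open>The Thue-Morse sequence and the Dekking curve\<close>

definition zeta :: "nat \<Rightarrow> complex" where
  "zeta m = exp (2 * of_real pi * \<i> / of_nat m)"

(* The numeral types 2 and 3 are the rings Z/2Z and Z/3Z. *)
fun thue_morse :: "nat \<Rightarrow> 2" where
  "thue_morse n = (if n = 0 then 0 else thue_morse (n div 2) + of_nat (n mod 2))"

declare thue_morse.simps [simp del]

lemma thue_morse_0: "thue_morse 0 = 0"
  by (simp add: thue_morse.simps)

lemma thue_morse_rec:
  assumes "s < 2"
  shows "thue_morse (2 * m + s) = thue_morse m + of_nat s"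
proof (cases "2 * m + s = 0")
  case True
  then show ?thesis by (simp add: thue_morse_0)
next
  case False
  have "(2 * m + s) div 2 = m" "(2 * m + s) mod 2 = s"
    using assms by auto
  then show ?thesis using False by (subst thue_morse.simps) (simp only: if_False)
qed

definition thue_morse_morphism :: "2 list \<Rightarrow> 2 list" where
  "thue_morse_morphism w = concat (map (\<lambda>a. if a = 0 then [0, 1] else [1, 0]) w)"

(* Rep_bit0 and Rep_bit1 yield the representatives in {0, 1} and {0, 1, 2}. *)
definition dekking_2_3_1 :: "(2 \<times> 3) turtle_curve" where
  "dekking_2_3_1 =
     (\<lambda>n. (thue_morse n, of_nat n),
      \<lambda>(x, y). translation ((-1) powi (Rep_bit0 x) * zeta 3 powi (Rep_bit1 y)))"

end

theory Submission
  imports Defs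
begin

text \<open>Write \<open>R(m) = \<Sum>i<m. (-1)^t(i) * \<zeta>^i\<close> with \<open>\<zeta> = zeta 3\<close> for the vertices of the Dekking curve.
  Since \<open>R(4 m) = 3 R(m)\<close>, the sets \<open>{R(m) / 3 ^ n | m < 4 ^ n}\<close> increase with \<open>n\<close>, and the
  \<open>n\<close>-th one is within \<open>2 / 3 ^ n\<close> of all the others; the limit is the closure of their union.
  For a Thue--Morse turtle curve \<open>T\<close> choose \<open>N = 2 ^ n\<close> such that the blocks \<open>\<phi>^n(0)\<close> and \<open>\<phi>^n(1)\<close>
  both have direction \<open>\<zeta>\<close>, and let \<open>s + c\<close> and \<open>s - c\<close> be their displacements. Then
  \<open>T(N m) = s * (\<Sum>i<m. \<zeta>^i) + c * R(m)\<close>, where the first sum is bounded, so \<open>T(i)\<close> stays within a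
  bounded distance of \<open>c * R(i div N)\<close>, which disappears on rescaling. The difference of the
  displacements of \<open>\<phi>^j(0)\<close> and \<open>\<phi>^j(1)\<close> is multiplied by \<open>1 - \<omega>\<close> when \<open>j\<close> increases, \<open>\<omega>\<close> being
  their direction; some iterated square of \<open>\<omega>\<close> is \<open>\<zeta>\<close>, so \<open>\<omega> \<noteq> 1\<close> and \<open>c \<noteq> 0\<close>.\<close>

section \<open>The Hausdorff distance\<close>

text \<open>A real \<open>SUP\<close> is meaningful only over a nonempty set that is bounded above.
  The bound \<open>e\<close> supplies the latter, so it also enters the proof of
  nonnegativity.\<close>

lemma hausdorff_dist_bounds:
  fixes A B :: "'a::metric_space set"
  assumes "A \<noteq> {}" "B \<noteq> {}"
    and AB: "\<And>x. x \<in> A \<Longrightarrow> \<exists>y\<in>B. dist x y \<le> e"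
    and BA: "\<And>y. y \<in> B \<Longrightarrow> \<exists>x\<in>A. dist y x \<le> e"
  shows "0 \<le> hausdorff_dist A B" "hausdorff_dist A B \<le> e"
proof -
  have A: "infdist x B \<le> e" if "x \<in> A" for x
    using AB[OF that] infdist_le2 by blast
  have B: "infdist y A \<le> e" if "y \<in> B" for y
    using BA[OF that] infdist_le2 by blast
  show "hausdorff_dist A B \<le> e"
    unfolding hausdorff_dist_def using assms(1,2) A B by (auto intro!: cSUP_least)
  obtain x where "x \<in> A" using assms(1) by blast
  have "0 \<le> infdist x B" by (rule infdist_nonneg)
  also have "\<dots> \<le> (SUP x\<in>A. infdist x B)"
    using \<open>x \<in> A\<close> A by (intro cSUP_upper bdd_aboveI2) auto
  finally show "0 \<le> hausdorff_dist A B"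
    unfolding hausdorff_dist_def by simp
qed

lemma hausdorff_limitI:
  fixes K :: "'a::metric_space set"
  assumes "K \<in> nonempty_compacts"
    and "\<forall>\<^sub>F n in sequentially. X n \<in> nonempty_compacts"
    and "\<forall>\<^sub>F n in sequentially. \<forall>x\<in>X n. \<exists>y\<in>K. dist x y \<le> e n"
    and "\<forall>\<^sub>F n in sequentially. \<forall>y\<in>K. \<exists>x\<in>X n. dist y x \<le> e n"
    and "e \<longlonglongrightarrow> 0"
  shows "hausdorff_limit X K"
  unfolding hausdorff_limit_def
proof (intro conjI assms)
  have ev: "\<forall>\<^sub>F n in sequentially.
      0 \<le> hausdorff_dist (X n) K \<and> hausdorff_dist (X n) K \<le> e n"
    using assms(2-4)
  proof eventually_elim
    case (elim n)
    then show ?case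
      using assms(1) hausdorff_dist_bounds[of "X n" K "e n"]
      by (auto simp: nonempty_compacts_def)
  qed
  show "(\<lambda>n. hausdorff_dist (X n) K) \<longlonglongrightarrow> 0"
    by (rule tendsto_sandwich[OF _ _ tendsto_const assms(5)])
      (use ev in \<open>auto elim: eventually_mono\<close>)
qed

section \<open>Polygonal paths\<close>

lemma compact_polygonal_path: "compact (polygonal_path w)"
  unfolding polygonal_path_def by (intro compact_UN) auto

lemma nth_in_polygonal_path:
  assumes "i < length w" "2 \<le> length w"
  shows "w ! i \<in> polygonal_path w"
proof (cases "Suc i < length w")
  case True
  then show ?thesis
    unfolding polygonal_path_def by (intro UN_I[of i]) auto
next
  \<comment> \<open>The last vertex starts no segment; it is the right end of the segment before it,
    which exists because there are at least two vertices.\<close>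
  case False
  with assms obtain j where "i = Suc j" "j < length w - 1"
    by (cases i) auto
  then show ?thesis
    unfolding polygonal_path_def by (intro UN_I[of j]) auto
qed

text \<open>Trades a path for its vertices at the cost of one step length: a point of a segment is
  no farther from the left end than the right end is.\<close>

lemma polygonal_path_near_vertex:
  assumes "x \<in> polygonal_path w"
    and "\<And>i. Suc i < length w \<Longrightarrow> dist (w ! i) (w ! Suc i) \<le> L"
  obtains i where "i < length w" "dist x (w ! i) \<le> L"
proof -
  obtain i where i: "i < length w - 1" "x \<in> closed_segment (w ! i) (w ! Suc i)"
    using assms(1) unfolding polygonal_path_def by auto
  have "dist x (w ! i) \<le> dist (w ! i) (w ! Suc i)"
    using segment_bound(1)[OF i(2)] by (simp add: dist_norm norm_minus_commute)
  also have "\<dots> \<le> L" using i(1) by (intro assms(2)) auto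
  finally show thesis using that[of i] i(1) by auto
qed

section \<open>The third root of unity\<close>

lemma zeta_powi: "zeta m powi j = exp (of_int j * (2 * of_real pi * \<i> / of_nat m))"
  unfolding zeta_def by (simp add: exp_power_int)

lemma zeta_3_cubed: "zeta 3 ^ 3 = 1"
  unfolding zeta_def by (simp add: mult.commute mult.left_commute flip: exp_of_nat_mult)

lemma norm_zeta [simp]: "norm (zeta m) = 1"
  unfolding zeta_def by (simp add: norm_exp_eq_Re)

lemma zeta_3_neq_1: "zeta 3 \<noteq> 1"
  unfolding zeta_def exp_eq_1
proof
  assume "Re (2 * of_real pi * \<i> / of_nat 3) = 0 \<and>
    (\<exists>n::int. Im (2 * of_real pi * \<i> / of_nat 3) = of_int (2 * n) * pi)"
  then obtain n :: int where "2 * pi / 3 = of_int (2 * n) * pi" by auto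
  then have "real_of_int (3 * n) = 1" by (simp add: field_simps)
  then have "3 * n = 1" by linarith
  then show False by presburger
qed

lemma zeta_3_sum: "1 + zeta 3 + zeta 3 ^ 2 = 0"
proof -
  have "(zeta 3 - 1) * (1 + zeta 3 + zeta 3 ^ 2) = zeta 3 ^ 3 - 1"
    by (simp add: algebra_simps power2_eq_square power3_eq_cube)
  then show ?thesis using zeta_3_neq_1 by (simp add: zeta_3_cubed)
qed

lemma zeta_3_power_mod: "zeta 3 ^ (n mod 3) = zeta 3 ^ n"
proof -
  have "zeta 3 ^ n = zeta 3 ^ (3 * (n div 3) + n mod 3)" by simp
  also have "\<dots> = zeta 3 ^ (n mod 3)" by (simp only: power_add power_mult zeta_3_cubed) simp
  finally show ?thesis ..
qed

lemma zeta_3_powi_mod: "zeta 3 powi (j mod 3) = zeta 3 powi j"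
proof -
  have "zeta 3 \<noteq> 0" by (simp add: zeta_def)
  have "zeta 3 powi j = zeta 3 powi (3 * (j div 3) + j mod 3)" by simp
  also have "\<dots> = zeta 3 powi (3 * (j div 3)) * zeta 3 powi (j mod 3)"
    using \<open>zeta 3 \<noteq> 0\<close> by (intro power_int_add) auto
  also have "zeta 3 powi (3 * (j div 3)) = 1"
    by (simp only: power_int_mult power_int_numeral zeta_3_cubed) simp
  finally show ?thesis by simp
qed

text \<open>Raising to the power \<open>2 ^ b\<close> leaves a primitive third root of unity,
  and one more squaring exchanges the two primitive third roots of unity.\<close>

lemma zeta_squarings:
  fixes k :: int
  assumes "gcd k 6 = 1"
  obtains m where "(zeta (3 * 2 ^ b) powi k) ^ 2 ^ m = zeta 3"
proof -
  have pow: "(zeta (3 * 2 ^ b) powi k) ^ 2 ^ b = zeta 3 powi k"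
    unfolding zeta_powi by (simp flip: exp_of_nat_mult)
  have "\<not> 3 dvd k"
  proof
    assume "3 dvd k"
    then have "3 dvd gcd k 6" by simp
    then show False using assms by simp
  qed
  then have "k mod 3 = 1 \<or> k mod 3 = 2" by presburger
  then consider "k mod 3 = 1" | "k mod 3 = 2" by blast
  then show thesis
  proof cases
    case 1
    then show ?thesis
      using that[of b] pow zeta_3_powi_mod[of k] by simp
  next
    case 2
    have "(zeta (3 * 2 ^ b) powi k) ^ 2 ^ Suc b = (zeta 3 powi k) ^ 2"
      by (simp add: pow mult.commute[of 2] power_mult)
    also have "zeta 3 powi k = zeta 3 ^ 2"
      using 2 zeta_3_powi_mod[of k] by simp
    also have "(zeta 3 ^ 2) ^ 2 = zeta 3"
      using zeta_3_power_mod[of 4] by simp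
    finally show ?thesis by (rule that)
  qed
qed

section \<open>The Thue--Morse sequence\<close>

lemma bit_cases: "(x::2) = 0 \<or> x = 1"
  using exhaust_2[of x] by auto

lemma bit_two_eq_0 [simp]: "(2::2) = 0"
  by simp

definition bit_sign :: "2 \<Rightarrow> complex" where
  "bit_sign x = (if x = 0 then 1 else - 1)"

lemma bit_sign_add_1 [simp]: "bit_sign (x + 1) = - bit_sign x"
  using bit_cases[of x] by (auto simp: bit_sign_def)

lemma norm_bit_sign [simp]: "norm (bit_sign x) = 1"
  by (simp add: bit_sign_def)

lemma thue_morse_double: "thue_morse (2 * m) = thue_morse m"
  using thue_morse_rec[of 0 m] by simp

lemma thue_morse_Suc_double: "thue_morse (Suc (2 * m)) = thue_morse m + 1"
  using thue_morse_rec[of 1 m] by simp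

section \<open>The vertices of the Dekking curve\<close>

lemma turtle_pos_add: "turtle_pos (x + y) = turtle_pos x + turtle_dir x * turtle_pos y"
  by transfer auto

lemma turtle_dir_add: "turtle_dir (x + y) = turtle_dir x * turtle_dir y"
  by transfer auto

lemma turtle_pos_0 [simp]: "turtle_pos 0 = 0"
  by transfer simp

lemma turtle_dir_0 [simp]: "turtle_dir 0 = 1"
  by transfer simp

lemma norm_turtle_dir [simp]: "norm (turtle_dir x) = 1"
  by transfer auto

lemma turtle_pos_translation [simp]: "turtle_pos (translation c) = c"
  by transfer simp

lemma turtle_dir_translation [simp]: "turtle_dir (translation c) = 1"
  by transfer simp

definition dekking_vertex :: "nat \<Rightarrow> complex" where
  "dekking_vertex m = (\<Sum>i<m. bit_sign (thue_morse i) * zeta 3 ^ i)"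

lemma dekking_vertex_0 [simp]: "dekking_vertex 0 = 0"
  by (simp add: dekking_vertex_def)

lemma dekking_vertex_Suc:
  "dekking_vertex (Suc m) = dekking_vertex m + bit_sign (thue_morse m) * zeta 3 ^ m"
  by (simp add: dekking_vertex_def)

lemma norm_dekking_vertex_diff: "norm (dekking_vertex (m + r) - dekking_vertex m) \<le> real r"
proof (induction r)
  case (Suc r)
  have "norm (dekking_vertex (m + Suc r) - dekking_vertex (m + r)) = 1"
    by (simp add: dekking_vertex_Suc norm_mult norm_power)
  then show ?case
    using Suc norm_diff_triangle_le[of "dekking_vertex (m + Suc r)" "dekking_vertex (m + r)" 1
        "dekking_vertex m" "real r"] by simp
qed simp

lemma dekking_letter:
  "snd dekking_2_3_1 (fst dekking_2_3_1 n) = translation (bit_sign (thue_morse n) * zeta 3 ^ n)"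
proof -
  have "(-1) powi (Rep_bit0 x) = bit_sign x" for x :: 2
    using bit_cases[of x] by (auto simp: bit_sign_def bit0.Rep_0 bit0.Rep_1)
  moreover have "Rep_bit1 (of_nat n :: 3) = int (n mod 3)"
    by (simp add: bit1.of_nat_eq zmod_int bit1.Rep_Abs_mod[where ?'a = 1, simplified])
  ultimately show ?thesis
    by (simp add: dekking_2_3_1_def zeta_3_power_mod)
qed

lemma turtle_point_dekking: "turtle_point dekking_2_3_1 = dekking_vertex"
proof
  fix m
  have "turtle_pos (\<Sum>i\<leftarrow>[0..<m]. snd dekking_2_3_1 (fst dekking_2_3_1 i)) = dekking_vertex m \<and>
     turtle_dir (\<Sum>i\<leftarrow>[0..<m]. snd dekking_2_3_1 (fst dekking_2_3_1 i)) = 1"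
    by (induction m)
      (simp_all add: turtle_pos_add turtle_dir_add dekking_letter dekking_vertex_Suc)
  then show "turtle_point dekking_2_3_1 m = dekking_vertex m"
    by (simp add: turtle_point_def)
qed

text \<open>The block \<open>0110\<close> contributes \<open>1 - \<zeta> - \<zeta>\<^sup>2 + 1 = 3\<close>.\<close>

lemma dekking_vertex_times_4: "dekking_vertex (4 * m) = 3 * dekking_vertex m"
proof (induction m)
  case (Suc m)
  let ?s = "bit_sign (thue_morse m)"
  have t: "thue_morse (4 * m) = thue_morse m" "thue_morse (Suc (4 * m)) = thue_morse m + 1"
    "thue_morse (Suc (Suc (4 * m))) = thue_morse m + 1"
    "thue_morse (Suc (Suc (Suc (4 * m)))) = thue_morse m + 1 + 1"
    using thue_morse_double[of "2 * m"] thue_morse_Suc_double[of "2 * m"]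
      thue_morse_double[of "Suc (2 * m)"] thue_morse_Suc_double[of "Suc (2 * m)"]
      thue_morse_double[of m] thue_morse_Suc_double[of m] by simp_all
  \<comment> \<open>Since 4 = 1 modulo 3, the block that replaces letter \<open>m\<close> starts
    with the same power of \<open>zeta 3\<close> as that letter.\<close>
  have "zeta 3 ^ 4 = zeta 3"
    using zeta_3_power_mod[of 4] by simp
  then have z: "zeta 3 ^ (4 * m) = zeta 3 ^ m"
    by (simp add: power_mult)
  have "4 * Suc m = Suc (Suc (Suc (Suc (4 * m))))" by simp
  then have "dekking_vertex (4 * Suc m) = dekking_vertex (4 * m)
      + zeta 3 ^ (4 * m) * ?s * (1 - zeta 3 - zeta 3 ^ 2 + zeta 3 ^ 3)"
    by (simp only: dekking_vertex_Suc t bit_sign_add_1)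
      (simp add: algebra_simps power2_eq_square power3_eq_cube)
  also have "1 - zeta 3 - zeta 3 ^ 2 + zeta 3 ^ 3 = 3"
    using zeta_3_sum zeta_3_cubed by algebra
  finally show ?case
    by (simp only: Suc z dekking_vertex_Suc) (simp add: algebra_simps)
qed simp

lemma dekking_vertex_times_power:
  "dekking_vertex (4 ^ j * m) = 3 ^ j * dekking_vertex m"
  by (induction j) (simp_all add: dekking_vertex_times_4 mult.assoc)

text \<open>The base-4 digits of \<open>i\<close> are dropped one at a time. Digit number l stands
  for at most 3 unit steps, scaled by 3^l. These errors sum to 3 (3^j - 1) / 2, and the constant 2
  leaves some slack.\<close>

lemma dekking_vertex_div:
  "norm (dekking_vertex i - 3 ^ j * dekking_vertex (i div 4 ^ j)) \<le> 2 * (3 ^ j - 1)"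
proof (induction j)
  case (Suc j)
  define n where "n = i div 4 ^ j"
  have "norm (dekking_vertex n - 3 * dekking_vertex (n div 4)) \<le> real (n mod 4)"
    using norm_dekking_vertex_diff[of "4 * (n div 4)" "n mod 4"]
    by (simp add: dekking_vertex_times_4)
  also have "\<dots> \<le> 3" using mod_less_divisor[of 4 n] by linarith
  finally have "norm (3 ^ j * (dekking_vertex n - 3 * dekking_vertex (n div 4))) \<le> 3 ^ j * 3"
    by (simp add: norm_mult norm_power)
  moreover have "n div 4 = i div 4 ^ Suc j"
    by (simp add: n_def div_mult2_eq[symmetric] mult.commute)
  ultimately have "norm ((dekking_vertex i - 3 ^ j * dekking_vertex n) +
      (3 ^ j * dekking_vertex n - 3 ^ Suc j * dekking_vertex (i div 4 ^ Suc j)))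
      \<le> 2 * (3 ^ j - 1) + 3 ^ j * 3"
    using Suc by (intro order_trans[OF norm_triangle_ineq] add_mono)
      (simp_all add: n_def algebra_simps)
  also have "\<dots> \<le> 2 * (3 ^ Suc j - 1)" by simp
  finally show ?case by simp
qed simp

section \<open>The limit of the Dekking curve\<close>

definition dekking_level :: "nat \<Rightarrow> complex set" where
  "dekking_level n = (\<lambda>m. dekking_vertex m / 3 ^ n) ` {..<4 ^ n}"

definition dekking_limit :: "complex set" where
  "dekking_limit = closure (\<Union>n. dekking_level n)"

lemma dekking_level_subset: "dekking_level n \<subseteq> dekking_limit"
  unfolding dekking_limit_def by (rule order_trans[OF _ closure_subset]) blast

lemma dekking_level_add: "dekking_level n \<subseteq> dekking_level (n + j)"
proof
  fix x assume "x \<in> dekking_level n"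
  then obtain m where m: "m < 4 ^ n" "x = dekking_vertex m / 3 ^ n"
    unfolding dekking_level_def by auto
  have "x = dekking_vertex (4 ^ j * m) / 3 ^ (n + j)"
    by (simp add: m dekking_vertex_times_power power_add)
  moreover have "4 ^ j * m < 4 ^ (n + j)"
    using m(1) by (simp add: power_add)
  ultimately show "x \<in> dekking_level (n + j)"
    unfolding dekking_level_def by blast
qed

lemma dekking_level_near:
  "dekking_level k \<subseteq> (\<Union>v\<in>dekking_level n. cball v (2 / 3 ^ n))"
proof -
  have "\<exists>v\<in>dekking_level n. dist v x \<le> 2 / 3 ^ n" if x: "x \<in> dekking_level (n + k)" for x
  proof -
    obtain i where i: "i < 4 ^ (n + k)" "x = dekking_vertex i / 3 ^ (n + k)"
      using x unfolding dekking_level_def by blast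
    have "i div 4 ^ k < 4 ^ n"
      using i(1) by (simp add: power_add less_mult_imp_div_less)
    moreover have "dist (dekking_vertex (i div 4 ^ k) / 3 ^ n) x \<le> 2 / 3 ^ n"
    proof -
      have "dekking_vertex (i div 4 ^ k) / 3 ^ n - x =
          - (dekking_vertex i - 3 ^ k * dekking_vertex (i div 4 ^ k)) / 3 ^ (n + k)"
        by (simp add: i field_simps power_add)
      then have "dist (dekking_vertex (i div 4 ^ k) / 3 ^ n) x =
          norm (dekking_vertex i - 3 ^ k * dekking_vertex (i div 4 ^ k)) / 3 ^ (n + k)"
        by (simp add: dist_norm norm_divide norm_power norm_minus_commute)
      also have "\<dots> \<le> 2 * 3 ^ k / 3 ^ (n + k)"
        using dekking_vertex_div[of i k] by (intro divide_right_mono) auto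
      finally show ?thesis by (simp add: power_add)
    qed
    ultimately show ?thesis unfolding dekking_level_def by blast
  qed
  \<comment> \<open>Level \<open>k\<close> is contained in level \<open>n + k\<close>, so levels
    coarser than \<open>n\<close> are covered as well.\<close>
  then show ?thesis
    using dekking_level_add[of k n] by (force simp: add.commute)
qed

text \<open>Level \<open>n\<close> is finite, so its closed neighbourhood of radius
  \<open>2 / 3 ^ n\<close> is a closed set; containing every level, it contains the closure of their
  union.\<close>

lemma dekking_limit_near:
  assumes "z \<in> dekking_limit"
  obtains m where "m < 4 ^ n" "norm (z - dekking_vertex m / 3 ^ n) \<le> 2 / 3 ^ n"
proof -
  have "closed (\<Union>v\<in>dekking_level n. cball v (2 / 3 ^ n))"
    by (intro closed_UN) (auto simp: dekking_level_def)
  then have "dekking_limit \<subseteq> (\<Union>v\<in>dekking_level n. cball v (2 / 3 ^ n))"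
    unfolding dekking_limit_def using dekking_level_near
    by (intro closure_minimal UN_least) auto
  then show thesis
    using assms that by (auto simp: dekking_level_def dist_norm norm_minus_commute)
qed

lemma compact_dekking_limit: "compact dekking_limit"
proof -
  have "dekking_limit \<subseteq> cball 0 2"
  proof
    fix z assume "z \<in> dekking_limit"
    then show "z \<in> cball 0 2"
      \<comment> \<open>Level 0 consists of the point 0 alone, and the radius there is 2.\<close>
      by (rule dekking_limit_near[of _ 0]) auto
  qed
  then have "bounded dekking_limit" using bounded_cball bounded_subset by blast
  then show ?thesis by (simp add: compact_eq_bounded_closed dekking_limit_def)
qed

lemma dekking_limit_nontrivial: "1 / 3 \<in> dekking_limit"
proof -
  have "dekking_vertex 1 = 1"
    by (simp add: dekking_vertex_def bit_sign_def thue_morse_0)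
  then have "1 / 3 \<in> dekking_level 1"
    unfolding dekking_level_def by force
  then show ?thesis using dekking_level_subset by blast
qed

text \<open>Serves both curves: any \<open>q\<close> that shadows \<open>c * dekking_vertex\<close>,
  slowed down by a factor \<open>N\<close>, up to a bounded error has the same limit up to the
  factor \<open>c\<close>. The indices below \<open>N * 4 ^ n\<close> are exactly those with
  \<open>i div N < 4 ^ n\<close>.\<close>

lemma hausdorff_limit_near_dekking:
  fixes q :: "nat \<Rightarrow> complex"
  assumes near: "\<And>i. norm (q i - c * dekking_vertex (i div N)) \<le> M" and "0 < N"
  shows "hausdorff_limit
      (\<lambda>n. (\<lambda>z. inverse (3 ^ n) * z) ` polygonal_path (map q [0..<N * 4 ^ n]))
      ((\<lambda>z. c * z) ` dekking_limit)"
    (is "hausdorff_limit ?X ?K")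
proof (rule hausdorff_limitI)
  \<comment> \<open>\<open>L\<close> bounds one step of \<open>q\<close>: an error \<open>M\<close>
    at either end and at most one unit step of the Dekking curve, scaled by \<open>c\<close>.
    \<open>E\<close> covers both directions of the comparison: \<open>L + M\<close> from path to
    limit set, \<open>M + 2 * norm c\<close> back.\<close>
  define L where "L = 2 * M + norm c"
  define E where "E = L + M + 2 * norm c"
  have "0 \<le> M" using near[of 0] norm_ge_zero order_trans by blast
  have step: "norm (q i - q (Suc i)) \<le> L" for i
  proof -
    have "norm (dekking_vertex (i div N) - dekking_vertex (Suc i div N)) \<le> 1"
      using norm_dekking_vertex_diff[of "i div N" 1]
      by (auto simp: div_Suc norm_minus_commute)
    then have "norm (c * dekking_vertex (i div N) - c * dekking_vertex (Suc i div N)) \<le> norm c"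
      by (simp add: norm_mult mult_left_le flip: right_diff_distrib)
    then have "norm (q i - c * dekking_vertex (Suc i div N)) \<le> M + norm c"
      using near by (rule norm_diff_triangle_le[rotated])
    moreover have "norm (c * dekking_vertex (Suc i div N) - q (Suc i)) \<le> M"
      using near[of "Suc i"] by (simp add: norm_minus_commute)
    ultimately have "norm (q i - q (Suc i)) \<le> M + norm c + M"
      by (rule norm_diff_triangle_le)
    then show ?thesis by (simp add: L_def)
  qed
  have scaled: "norm (inverse (3 ^ n) * x - c * (y / 3 ^ n)) \<le> E / 3 ^ n"
    if "norm (x - c * y) \<le> E" for x y n
  proof -
    have "inverse (3 ^ n) * x - c * (y / 3 ^ n) = (x - c * y) / 3 ^ n"
      by (simp add: field_simps)
    then show ?thesis using that by (simp add: norm_divide norm_power divide_right_mono)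
  qed
  show "?K \<in> nonempty_compacts"
    using compact_dekking_limit dekking_limit_nontrivial
    by (auto simp: nonempty_compacts_def intro!: compact_continuous_image continuous_intros)
  \<comment> \<open>For \<open>n = 0\<close> and \<open>N = 1\<close> there is a single vertex and
    the path is empty; hence \<open>1 \<le> n\<close>.\<close>
  have vertex: "inverse (3 ^ n) * q i \<in> ?X n" if "1 \<le> n" "i < N * 4 ^ n" for n i
  proof -
    have "1 * 4 ^ 1 \<le> N * 4 ^ n"
      using \<open>0 < N\<close> that(1) by (intro mult_le_mono power_increasing) auto
    then have "2 \<le> N * 4 ^ n" by simp
    then show ?thesis
      using nth_in_polygonal_path[of i "map q [0..<N * 4 ^ n]"] that(2) by auto
  qed
  show "\<forall>\<^sub>F n in sequentially. ?X n \<in> nonempty_compacts"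
    using eventually_ge_at_top[of 1]
  proof eventually_elim
    case (elim n)
    have "?X n \<noteq> {}" using vertex[OF elim, of 0] \<open>0 < N\<close> by auto
    moreover have "compact (?X n)"
      by (intro compact_continuous_image continuous_intros compact_polygonal_path)
    ultimately show ?case unfolding nonempty_compacts_def by simp
  qed
  show "\<forall>\<^sub>F n in sequentially. \<forall>x\<in>?X n. \<exists>y\<in>?K. dist x y \<le> E / 3 ^ n"
  proof (intro always_eventually allI ballI)
    fix n x assume "x \<in> ?X n"
    then obtain x' where x': "x' \<in> polygonal_path (map q [0..<N * 4 ^ n])"
      "x = inverse (3 ^ n) * x'" by auto
    obtain i where i: "i < N * 4 ^ n" "dist x' (q i) \<le> L"
      using polygonal_path_near_vertex[OF x'(1), of L thesis] step
      by (auto simp: dist_norm)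
    have "dekking_vertex (i div N) / 3 ^ n \<in> dekking_level n"
      unfolding dekking_level_def using i(1) by (auto simp: less_mult_imp_div_less mult.commute)
    then have K: "dekking_vertex (i div N) / 3 ^ n \<in> dekking_limit"
      using dekking_level_subset by blast
    have "norm (x' - c * dekking_vertex (i div N)) \<le> E"
      using i(2) near[of i] norm_ge_zero[of c] unfolding E_def dist_norm by norm
    then have "dist x (c * (dekking_vertex (i div N) / 3 ^ n)) \<le> E / 3 ^ n"
      using scaled x'(2) by (simp add: dist_norm)
    then show "\<exists>y\<in>?K. dist x y \<le> E / 3 ^ n" using K by blast
  qed
  show "\<forall>\<^sub>F n in sequentially. \<forall>y\<in>?K. \<exists>x\<in>?X n. dist y x \<le> E / 3 ^ n"
    using eventually_ge_at_top[of 1]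
  proof eventually_elim
    case (elim n)
    show ?case
    proof
      fix y assume "y \<in> ?K"
      then obtain z where z: "z \<in> dekking_limit" "y = c * z" by auto
      obtain m where m: "m < 4 ^ n" "norm (z - dekking_vertex m / 3 ^ n) \<le> 2 / 3 ^ n"
        using dekking_limit_near[OF z(1)] by blast
      have "norm (3 ^ n * z - dekking_vertex m) = 3 ^ n * norm (z - dekking_vertex m / 3 ^ n)"
      proof -
        have "3 ^ n * z - dekking_vertex m = 3 ^ n * (z - dekking_vertex m / 3 ^ n)"
          by (simp add: right_diff_distrib)
        then show ?thesis by (simp add: norm_mult norm_power)
      qed
      also have "\<dots> \<le> 2" using m(2) by (simp add: field_simps)
      finally have "norm (dekking_vertex m - 3 ^ n * z) \<le> 2"
        by (simp add: norm_minus_commute)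
      then have "norm (c * dekking_vertex m - c * (3 ^ n * z)) \<le> norm c * 2"
        by (simp add: norm_mult mult_left_mono flip: right_diff_distrib)
      moreover have "norm (q (N * m) - c * dekking_vertex m) \<le> M"
        using near[of "N * m"] \<open>0 < N\<close> by simp
      ultimately have "norm (q (N * m) - c * (3 ^ n * z)) \<le> M + norm c * 2"
        by (rule norm_diff_triangle_le[rotated])
      also have "\<dots> \<le> E"
        using \<open>0 \<le> M\<close> by (simp add: E_def L_def)
      finally have "norm (q (N * m) - c * (3 ^ n * z)) \<le> E" .
      then have "dist y (inverse (3 ^ n) * q (N * m)) \<le> E / 3 ^ n"
        using scaled[of "q (N * m)" "3 ^ n * z" n] by (simp add: z dist_norm norm_minus_commute)
      moreover have "N * m < N * 4 ^ n" using m(1) \<open>0 < N\<close> by simp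
      ultimately show "\<exists>x\<in>?X n. dist y x \<le> E / 3 ^ n"
        using vertex[OF elim] by blast
    qed
  qed
  have "(\<lambda>n. E * (1 / 3) ^ n) \<longlonglongrightarrow> 0"
    by (rule tendsto_mult_right_zero, rule LIMSEQ_power_zero) simp
  then show "(\<lambda>n. E / 3 ^ n) \<longlonglongrightarrow> 0"
    by (simp add: power_divide)
qed

section \<open>Thue--Morse turtle curves\<close>

text \<open>\<open>morphic_sum \<tau> n x\<close> is the sum of the letters of the \<open>n\<close>-th image of \<open>x\<close> under the
  Thue--Morse morphism.\<close>

primrec morphic_sum :: "(2 \<Rightarrow> turtle) \<Rightarrow> nat \<Rightarrow> 2 \<Rightarrow> turtle" where
  "morphic_sum \<tau> 0 x = \<tau> x"
| "morphic_sum \<tau> (Suc n) x = morphic_sum \<tau> n x + morphic_sum \<tau> n (x + 1)"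

lemma sum_list_upt_append:
  fixes f :: "nat \<Rightarrow> 'a::monoid_add"
  assumes "i \<le> j" "j \<le> k"
  shows "(\<Sum>x\<leftarrow>[i..<k]. f x) = (\<Sum>x\<leftarrow>[i..<j]. f x) + (\<Sum>x\<leftarrow>[j..<k]. f x)"
proof -
  have "[i..<k] = [i..<j] @ [j..<k]"
    using assms by (metis le_Suc_ex upt_add_eq_append)
  then show ?thesis by simp
qed

text \<open>The block splits into the halves numbered \<open>2 * m\<close> and
  \<open>2 * m + 1\<close>, whose Thue-Morse letters are \<open>thue_morse m\<close> and its
  complement, matching the recursion of \<open>morphic_sum\<close>.\<close>

lemma sum_list_thue_morse_block:
  "(\<Sum>i\<leftarrow>[2 ^ n * m..<2 ^ n * Suc m]. \<tau> (thue_morse i)) = morphic_sum \<tau> n (thue_morse m)"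
proof (induction n arbitrary: m)
  case (Suc n)
  have "(\<Sum>i\<leftarrow>[2 ^ n * (2 * m)..<2 ^ n * Suc (Suc (2 * m))]. \<tau> (thue_morse i)) =
      (\<Sum>i\<leftarrow>[2 ^ n * (2 * m)..<2 ^ n * Suc (2 * m)]. \<tau> (thue_morse i)) +
      (\<Sum>i\<leftarrow>[2 ^ n * Suc (2 * m)..<2 ^ n * Suc (Suc (2 * m))]. \<tau> (thue_morse i))"
    by (rule sum_list_upt_append) auto
  then show ?case
    by (simp only: Suc morphic_sum.simps thue_morse_double thue_morse_Suc_double)
      (simp add: algebra_simps)
qed simp

text \<open>Directions multiply commutatively, so the first image under the morphism already erases
  the dependence on \<open>x\<close>; each further image squares the direction.\<close>

lemma turtle_dir_morphic_sum:
  "turtle_dir (morphic_sum \<tau> (Suc n) x) = turtle_dir (\<tau> 0 + \<tau> 1) ^ 2 ^ n"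
proof (induction n arbitrary: x)
  case 0
  show ?case using bit_cases[of x] by (auto simp: turtle_dir_add)
next
  case (Suc n)
  show ?case
    by (subst morphic_sum.simps(2), subst turtle_dir_add, subst (1 2) Suc)
      (simp add: mult_2 flip: power_add)
qed

text \<open>With displacements p and q and common direction w, the next pair is p + w q and q + w p,
  whose difference is (1 - w)(p - q). Here w = 1 would force all later squarings, up to the
  \<open>2 ^ m\<close>-th power, to be 1.\<close>

lemma morphic_sum_pos_neq:
  assumes "turtle_pos (\<tau> 0 + \<tau> 1) \<noteq> turtle_pos (\<tau> 1 + \<tau> 0)"
    and "turtle_dir (\<tau> 0 + \<tau> 1) ^ 2 ^ m \<noteq> 1" "n \<le> m"
  shows "turtle_pos (morphic_sum \<tau> (Suc n) 0) \<noteq> turtle_pos (morphic_sum \<tau> (Suc n) 1)"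
  using assms(3)
proof (induction n)
  case 0
  show ?case using assms(1) by simp
next
  case (Suc n)
  define w where "w = turtle_dir (\<tau> 0 + \<tau> 1) ^ 2 ^ n"
  have "w \<noteq> 1"
  proof
    assume "w = 1"
    then have "w ^ 2 ^ (m - n) = 1" by simp
    moreover have "2 ^ n * 2 ^ (m - n) = (2::nat) ^ m"
      using Suc.prems by (simp flip: power_add)
    ultimately show False
      using assms(2) unfolding w_def by (simp flip: power_mult)
  qed
  have rec: "turtle_pos (morphic_sum \<tau> (Suc (Suc n)) x) =
      turtle_pos (morphic_sum \<tau> (Suc n) x) + w * turtle_pos (morphic_sum \<tau> (Suc n) (x + 1))" for x
    by (subst morphic_sum.simps(2), subst turtle_pos_add)
      (simp only: turtle_dir_morphic_sum w_def)
  have "turtle_pos (morphic_sum \<tau> (Suc (Suc n)) 0) - turtle_pos (morphic_sum \<tau> (Suc (Suc n)) 1) =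
      (1 - w) * (turtle_pos (morphic_sum \<tau> (Suc n) 0) - turtle_pos (morphic_sum \<tau> (Suc n) 1))"
    by (simp only: rec) (simp add: algebra_simps)
  moreover have "\<dots> \<noteq> 0" using Suc \<open>w \<noteq> 1\<close> by simp
  ultimately show ?case by (metis right_minus_eq)
qed

text \<open>Both kinds of block turn the turtle by the same \<open>w\<close>, so block number
  \<open>i\<close> is traversed with initial heading \<open>w ^ i\<close>, whatever the preceding
  letters are.\<close>

lemma turtle_point_block:
  assumes dir: "\<And>x. turtle_dir (morphic_sum \<tau> n x) = w"
  shows "turtle_point (thue_morse, \<tau>) (2 ^ n * m) =
    (\<Sum>i<m. w ^ i * turtle_pos (morphic_sum \<tau> n (thue_morse i)))"
proof -
  have "turtle_pos (\<Sum>i\<leftarrow>[0..<2 ^ n * m]. \<tau> (thue_morse i)) =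
      (\<Sum>i<m. w ^ i * turtle_pos (morphic_sum \<tau> n (thue_morse i))) \<and>
    turtle_dir (\<Sum>i\<leftarrow>[0..<2 ^ n * m]. \<tau> (thue_morse i)) = w ^ m"
  proof (induction m)
    case (Suc m)
    have "(\<Sum>i\<leftarrow>[0..<2 ^ n * Suc m]. \<tau> (thue_morse i)) =
        (\<Sum>i\<leftarrow>[0..<2 ^ n * m]. \<tau> (thue_morse i)) + morphic_sum \<tau> n (thue_morse m)"
      by (subst sum_list_upt_append[of _ "2 ^ n * m"]) (auto simp only: sum_list_thue_morse_block, auto)
    then show ?case
      using Suc by (simp only: turtle_pos_add turtle_dir_add dir) simp
  qed simp
  then show ?thesis by (simp add: turtle_point_def)
qed

lemma norm_turtle_point_diff:
  assumes "\<And>a. norm (turtle_pos (\<tau> a)) \<le> L"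
  shows "norm (turtle_point (s, \<tau>) (m + r) - turtle_point (s, \<tau>) m) \<le> real r * L"
proof (induction r)
  case (Suc r)
  have "turtle_point (s, \<tau>) (Suc n) - turtle_point (s, \<tau>) n =
      turtle_dir (\<Sum>i\<leftarrow>[0..<n]. \<tau> (s i)) * turtle_pos (\<tau> (s n))" for n
    by (simp add: turtle_point_def turtle_pos_add)
  then have "norm (turtle_point (s, \<tau>) (Suc (m + r)) - turtle_point (s, \<tau>) (m + r)) \<le> L"
    using assms by (simp add: norm_mult)
  then have "norm (turtle_point (s, \<tau>) (Suc (m + r)) - turtle_point (s, \<tau>) m) \<le> L + real r * L"
    using Suc by (rule norm_diff_triangle_le)
  then show ?case by (simp add: algebra_simps)
qed simp

lemma turtle_point_near_dekking:
  fixes \<tau> :: "2 \<Rightarrow> turtle"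
  assumes dir: "\<And>x. turtle_dir (morphic_sum \<tau> n x) = zeta 3"
  defines "c \<equiv> (turtle_pos (morphic_sum \<tau> n 0) - turtle_pos (morphic_sum \<tau> n 1)) / 2"
  obtains M where
    "\<And>i. norm (turtle_point (thue_morse, \<tau>) i - c * dekking_vertex (i div 2 ^ n)) \<le> M"
proof -
  define s where "s = (turtle_pos (morphic_sum \<tau> n 0) + turtle_pos (morphic_sum \<tau> n 1)) / 2"
  define L where "L = norm (turtle_pos (\<tau> 0)) + norm (turtle_pos (\<tau> 1))"
  define G where "G = 2 / norm (zeta 3 - 1)"
  have L: "norm (turtle_pos (\<tau> a)) \<le> L" for a
    using bit_cases[of a] by (auto simp: L_def)
  have geometric: "norm (\<Sum>i<m. zeta 3 ^ i) \<le> G" for m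
  proof -
    have "norm (zeta 3 ^ m - 1) \<le> 2"
      by (rule order_trans[OF norm_triangle_ineq4]) (simp add: norm_power)
    then show ?thesis
      using zeta_3_neq_1 by (simp add: geometric_sum norm_divide G_def divide_right_mono)
  qed
  have letter: "turtle_pos (morphic_sum \<tau> n x) = s + bit_sign x * c" for x
    using bit_cases[of x] by (auto simp: bit_sign_def s_def c_def field_simps)
  have block: "turtle_point (thue_morse, \<tau>) (2 ^ n * m) =
      s * (\<Sum>i<m. zeta 3 ^ i) + c * dekking_vertex m" for m
    by (simp add: turtle_point_block[OF dir] letter dekking_vertex_def sum_distrib_left
        sum.distrib distrib_left) (simp add: mult_ac)
  show thesis
  \<comment> \<open>The first term bounds the way from the start of the current block to index
    \<open>i\<close>, the second the bounded drift \<open>s * (\<Sum>i<m. zeta 3 ^ i)\<close> at the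
    block start.\<close>
  proof (rule that[of "real (2 ^ n) * L + norm s * G"])
    fix i :: nat
    define m r where "m = i div 2 ^ n" and "r = i mod 2 ^ n"
    have i: "i = 2 ^ n * m + r" by (simp add: m_def r_def)
    have "r < 2 ^ n" by (simp add: r_def)
    then have "real r * L \<le> real (2 ^ n) * L"
      by (intro mult_right_mono) (auto simp: L_def less_imp_le simp flip: of_nat_power)
    then have "norm (turtle_point (thue_morse, \<tau>) i - turtle_point (thue_morse, \<tau>) (2 ^ n * m))
        \<le> real (2 ^ n) * L"
      using norm_turtle_point_diff[of \<tau> L thue_morse "2 ^ n * m" r] L i by simp
    moreover have "norm (turtle_point (thue_morse, \<tau>) (2 ^ n * m) - c * dekking_vertex m)
        \<le> norm s * G"
      using geometric[of m] by (simp add: block norm_mult mult_left_mono)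
    ultimately show "norm (turtle_point (thue_morse, \<tau>) i - c * dekking_vertex (i div 2 ^ n))
        \<le> real (2 ^ n) * L + norm s * G"
      unfolding m_def[symmetric] by (rule norm_diff_triangle_le)
  qed
qed

theorem corollary6p1:
  fixes T :: "2 turtle_curve" and \<tau> :: "2 \<Rightarrow> turtle" and b :: nat and k :: int
  assumes "T = (thue_morse, \<tau>)"
    and "word_dir T (thue_morse_morphism [0]) = zeta (3 * 2 ^ b) powi k"
    and "gcd k 6 = 1"
    and "word_pos T (thue_morse_morphism [0]) \<noteq> word_pos T (thue_morse_morphism [1])"
  shows "\<exists>K \<in> nonempty_compacts. K \<noteq> {0} \<and>
           limit_curve dekking_2_3_1 K \<and> limit_curve T K \<and>
           hausdorff_limit
             (\<lambda>n. (\<lambda>z. inverse (3 ^ n) * z) ` polygonal_path (turtle_prefix dekking_2_3_1 (4 ^ n)))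
             K"
proof (intro bexI[of _ dekking_limit] conjI)
  show K: "dekking_limit \<in> nonempty_compacts"
    using compact_dekking_limit dekking_limit_nontrivial by (auto simp: nonempty_compacts_def)
  show "dekking_limit \<noteq> {0}"
  proof
    assume "dekking_limit = {0}"
    then have "1 / 3 \<in> {0::complex}" using dekking_limit_nontrivial by (simp only:)
    then show False by simp
  qed
  \<comment> \<open>The Dekking curve shadows itself exactly: \<open>c = 1\<close>,
    \<open>N = 1\<close>, error 0.\<close>
  show lim: "hausdorff_limit
      (\<lambda>n. (\<lambda>z. inverse (3 ^ n) * z) ` polygonal_path (turtle_prefix dekking_2_3_1 (4 ^ n)))
      dekking_limit"
    using hausdorff_limit_near_dekking[of dekking_vertex 1 1 0]
    by (simp add: turtle_prefix_def turtle_point_dekking)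
  have "hausdorff_limit
      (\<lambda>n. (\<lambda>z. inverse (3 ^ n) * z) ` polygonal_path (turtle_prefix dekking_2_3_1 (4 ^ n)))
      ((\<lambda>z. 1 * z) ` dekking_limit)"
    using lim by simp
  then show "limit_curve dekking_2_3_1 dekking_limit"
    unfolding limit_curve_def using K
    by (intro conjI exI[of _ 3] exI[of _ 1] exI[of _ "\<lambda>n. 4 ^ n"]) auto
  have w: "turtle_dir (\<tau> 0 + \<tau> 1) = zeta (3 * 2 ^ b) powi k"
    and d: "turtle_pos (\<tau> 0 + \<tau> 1) \<noteq> turtle_pos (\<tau> 1 + \<tau> 0)"
    using assms by (simp_all add: word_dir_def word_pos_def word_sum_def thue_morse_morphism_def)
  obtain m where m: "turtle_dir (\<tau> 0 + \<tau> 1) ^ 2 ^ m = zeta 3"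
    using zeta_squarings[OF assms(3)] unfolding w by blast
  \<comment> \<open>Blocks of length \<open>2 ^ Suc m\<close> are used: one image makes the two
    directions equal, and \<open>m\<close> squarings turn them into \<open>zeta 3\<close>.\<close>
  define c where
    "c = (turtle_pos (morphic_sum \<tau> (Suc m) 0) - turtle_pos (morphic_sum \<tau> (Suc m) 1)) / 2"
  have "c \<noteq> 0"
    using morphic_sum_pos_neq[OF d, of m m] zeta_3_neq_1 by (simp add: m c_def)
  have "turtle_dir (morphic_sum \<tau> (Suc m) x) = zeta 3" for x
    by (simp only: turtle_dir_morphic_sum m)
  then obtain M where
    "\<And>i. norm (turtle_point (thue_morse, \<tau>) i - c * dekking_vertex (i div 2 ^ Suc m)) \<le> M"
    unfolding c_def by (rule turtle_point_near_dekking) blast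
  then have "hausdorff_limit
      (\<lambda>n. (\<lambda>z. inverse (3 ^ n) * z) ` polygonal_path (turtle_prefix T (2 ^ Suc m * 4 ^ n)))
      ((\<lambda>z. c * z) ` dekking_limit)"
    unfolding turtle_prefix_def assms(1) by (rule hausdorff_limit_near_dekking) simp
  then show "limit_curve T dekking_limit"
    unfolding limit_curve_def using K \<open>c \<noteq> 0\<close>
    by (intro conjI exI[of _ 3] exI[of _ c] exI[of _ "\<lambda>n. 2 ^ Suc m * 4 ^ n"]) auto
qed

end
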